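(* If $r\ge3$ is an odd integer, then the hereditary $\mathcal L_r$-property $\mathcal P=\mathcal M_r$ of finite metric spaces with all distances in $\{1,\dots,r\}$ does not have a stability theorem.
   Context: For an integer $r\ge3$ let $\mathcal L_r=\{R_1(x,y),\dots,R_r(x,y)\}$ consist of $r$ binary relation symbols. A metric space with underlying set $V$ and all distances (between distinct points) in $[r]=\{1,\dots,r\}$ is viewed as an $\mathcal L_r$-structure with domain $V$ by: $R_i(x,y)$ holds iff $d(x,y)=i$. $\mathcal M_r$ is the class of $\mathcal L_r$-structures isomorphic to such a space with underlying set $[n]$ for some $n$; it is closed under isomorphism and substructures. Write $\mathcal P=\mathcal M_r$ and $\mathcal L=\mathcal L_r$ (maximum arity $2$; $r$ denotes only the largest distance). All types are quantifier-free. $\binom V2$ is the set of 2-element subsets of $V$. $S_2(\mathcal P)$ is the set of complete quantifier-free 2-types $p(x_1,x_2)$ containing $x_1\ne x_2$ and realized in some element of $\mathcal P$ (these are the types $p_i$, $i\in[r]$, saying that the distance between $x_1$ and $x_2$ is $i$). For a set $V$, $C_V=\{c_v:v\in V\}$ are new constants, and $S_2(C_V,\mathcal P)=\{p(c_u,c_v):p\in S_2(\mathcal P),u\ne v\in V\}$, where $p(c_u,c_v)$ is the set of sentences obtained by substitution. For an $\mathcal L$-structure $N$ and $A\subseteq\mathrm{dom}(N)$, $Diag^N(A)$ is the set of quantifier-free sentences in $\mathcal L\cup C_A$ true in $N$ when $c_a$ names $a$. $\mathcal L_{\mathcal P}=\{R_p:p\in S_2(\mathcal P)\}$, each $R_p$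 binary. An $\mathcal L_{\mathcal P}$-structure $M$ with domain $V$ is complete if for all $uv\in\binom V2$ some $R_p$ holds of $(u,v)$ or of $(v,u)$. It is an $\mathcal L_{\mathcal P}$-template if it is complete, no $R_p(u,u)$ holds, and whenever $p,p'\in S_2(\mathcal P)$ and a permutation $\mu$ of $\{1,2\}$ satisfy $p(\bar x)=p'(\mu(\bar x))$, then for all pairs $\bar a$ of distinct elements of $V$, $M\models R_p(\bar a)$ iff $M\models R_{p'}(\mu(\bar a))$, where $\mu(a_1,a_2)=(a_{\mu(1)},a_{\mu(2)})$. For $A\in\binom V2$, $Ch_M(A)=\{p(c_a,c_b)\in S_2(C_V,\mathcal P):\{a,b\}=A,\ M\models R_p(a,b)\}$. A choice function for $M$ is $\chi:\binom V2\to S_2(C_V,\mathcal P)$ with $\chi(A)\in Ch_M(A)$ for all $A$. For complete $M$, an $\mathcal L$-structure $N$ with domain $V$ is a full subpattern chosen by $\chi$, $N\unlhd_\chi M$, if $Diag^N(A)=\chi(A)$ for all $A\in\binom V2$; $N\unlhd_pM$ means $N\unlhd_\chi M$ for some $\chi$. $sub(M)=|\{N:N\unlhd_pM\}|$. $M$ is $\mathcal P$-random if it is complete and for every choice function $\chi$ there is $N\in\mathcal P$ with $N\unlhd_\chi M$. $\mathcal R(n,\mathcal P)$ is the class of $\mathcal P$-random $\mathcal L_{\mathcal P}$-templates with domain of size $n$; $ex(n,\mathcal P)=\max\{sub(M):M\in\mathcal R(n,\mathcal P)\}$; $\mathcal R_{ex}(n,\mathcal P)$ is the class of $M\in\mathcal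 R(n,\mathcal P)$ with $sub(M)=ex(n,\mathcal P)$. Two $\mathcal L_{\mathcal P}$-structures $M,M'$ with the same domain $V$ of size $n$ are $\delta$-close if the number of $A\in\binom V2$ such that for some enumeration $\bar a$ of $A$ the quantifier-free types of $\bar a$ in $M$ and in $M'$ differ is at most $\delta\binom n2$. $\mathcal P$ has a stability theorem if for all $\delta>0$ there are $\epsilon>0$ and $N$ such that for all $n>N$: if $M\in\mathcal R(n,\mathcal P)$ satisfies $sub(M)\ge ex(n,\mathcal P)^{1-\epsilon}$, then $M$ is $\delta$-close to some $M'\in\mathcal R_{ex}(n,\mathcal P)$ (with the same domain). *)

theory Defs
  imports "HOL-Analysis.Analysis" "HOL-Library.Ramsey" "HOL-Library.Infinite_Typeclass"
begin

text \<open>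
  A language with binary relation symbols only is given by its set of symbols. The type of
  structures is canonical in the sense that two structures for a language (see
  \<open>is_structure\<close>) are equal in HOL iff they are equal as structures; hence structures on a
  given domain can be counted with \<open>card\<close>.
\<close>

datatype ('s, 'v) struct = Struct (univ: "'v set") (interp: "'s \<Rightarrow> ('v \<times> 'v) set")

definition is_structure :: "'s set \<Rightarrow> ('s, 'v) struct \<Rightarrow> bool" where
  "is_structure L N \<longleftrightarrow>
     (\<forall>s\<in>L. interp N s \<subseteq> univ N \<times> univ N) \<and> (\<forall>s. s \<notin> L \<longrightarrow> interp N s = {})"

definition isomorphic :: "'s set \<Rightarrow> ('s, 'v) struct \<Rightarrow> ('s, 'w) struct \<Rightarrow> bool" where
  "isomorphic L N N' \<longleftrightarrow> (\<exists>f. bij_betw f (univ N) (univ N') \<and>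
     (\<forall>s\<in>L. \<forall>x\<in>univ N. \<forall>y\<in>univ N. (x, y) \<in> interp N s \<longleftrightarrow> (f x, f y) \<in> interp N' s))"

text \<open>
  Quantifier-free formulas over a set of terms. As there are no function symbols, a term is a
  variable or a constant. In this development it is either always a variable, the natural number
  \<open>i\<close> standing for \<open>x\<^sub>i\<close>, or (in sentences) always a constant, the element \<open>v\<close> standing for
  \<open>c\<^sub>v\<close>. The function \<open>rename id e\<close> is the substitution of \<open>e t\<close> for every term \<open>t\<close>.
\<close>

datatype (symbols: 's, terms: 't) qf =
    Equ 't 't
  | Rel 's 't 't
  | Neg "('s, 't) qf"
  | Conj "('s, 't) qf" "('s, 't) qf"
  for map: rename

definition qf_formulas :: "'s set \<Rightarrow> 't set \<Rightarrow> ('s, 't) qf set" where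
  "qf_formulas L T = {\<phi>. symbols \<phi> \<subseteq> L \<and> terms \<phi> \<subseteq> T}"

primrec sat :: "('s, 'v) struct \<Rightarrow> ('t \<Rightarrow> 'v) \<Rightarrow> ('s, 't) qf \<Rightarrow> bool" where
  "sat N e (Equ s t) \<longleftrightarrow> e s = e t"
| "sat N e (Rel R s t) \<longleftrightarrow> (e s, e t) \<in> interp N R"
| "sat N e (Neg \<phi>) \<longleftrightarrow> \<not> sat N e \<phi>"
| "sat N e (Conj \<phi> \<psi>) \<longleftrightarrow> sat N e \<phi> \<and> sat N e \<psi>"

text \<open>The quantifier-free type in \<open>N\<close> of the pair \<open>(a 1, a 2)\<close>.\<close>

definition qf_type :: "'s set \<Rightarrow> ('s, 'v) struct \<Rightarrow> (nat \<Rightarrow> 'v) \<Rightarrow> ('s, nat) qf set" where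
  "qf_type L N a = {\<phi> \<in> qf_formulas L {1, 2}. sat N a \<phi>}"

text \<open>
  The diagram of a set \<open>A\<close> of elements of \<open>N\<close>; the constant for \<open>a\<close> is interpreted by \<open>a\<close>.
\<close>

definition Diag :: "'s set \<Rightarrow> ('s, 'v) struct \<Rightarrow> 'v set \<Rightarrow> ('s, 'v) qf set" where
  "Diag L N A = {\<phi> \<in> qf_formulas L A. sat N id \<phi>}"

text \<open>
  Consistency is not part of this definition, since it is implied by \<open>realizes\<close>.
\<close>

definition complete_2_type :: "'s set \<Rightarrow> ('s, nat) qf set \<Rightarrow> bool" where
  "complete_2_type L p \<longleftrightarrow>
     p \<subseteq> qf_formulas L {1, 2} \<and> (\<forall>\<phi> \<in> qf_formulas L {1, 2}. \<phi> \<in> p \<or> Neg \<phi> \<in> p)"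

definition realizes :: "('s, 'v) struct \<Rightarrow> (nat \<Rightarrow> 'v) \<Rightarrow> ('s, nat) qf set \<Rightarrow> bool" where
  "realizes N a p \<longleftrightarrow> a 1 \<in> univ N \<and> a 2 \<in> univ N \<and> (\<forall>\<phi>\<in>p. sat N a \<phi>)"

text \<open>
  Below, \<open>P\<close> is a property of \<open>L\<close>-structures whose domains are subsets of the type \<open>'v\<close>.
\<close>

definition S2 :: "'s set \<Rightarrow> ('s, 'v) struct set \<Rightarrow> ('s, nat) qf set set" where
  "S2 L P = {p. complete_2_type L p \<and> Neg (Equ 1 2) \<in> p \<and> (\<exists>N\<in>P. \<exists>a. realizes N a p)}"

text \<open>The set of sentences \<open>p(c\<^sub>u, c\<^sub>v)\<close>.\<close>

definition inst :: "('s, nat) qf set \<Rightarrow> 'v \<Rightarrow> 'v \<Rightarrow> ('s, 'v) qf set" where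
  "inst p u v = rename id (\<lambda>i. if i = 1 then u else v) ` p"

definition S2_consts :: "'s set \<Rightarrow> ('s, 'v) struct set \<Rightarrow> 'v set \<Rightarrow> ('s, 'v) qf set set" where
  "S2_consts L P V = {inst p u v | p u v. p \<in> S2 L P \<and> u \<in> V \<and> v \<in> V \<and> u \<noteq> v}"

text \<open>
  The symbols of the language \<open>L\<^sub>P\<close> are the elements \<open>p\<close> of \<open>S2 L P\<close> themselves,
  \<open>p\<close> standing for \<open>R\<^sub>p\<close>.
\<close>

type_synonym ('s, 'v) pattern = "(('s, nat) qf set, 'v) struct"

definition complete :: "'s set \<Rightarrow> ('s, 'v) struct set \<Rightarrow> ('s, 'v) pattern \<Rightarrow> bool" where
  "complete L P M \<longleftrightarrow> is_structure (S2 L P) M \<and>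
     (\<forall>u v. {u, v} \<in> nsets (univ M) 2 \<longrightarrow>
        (\<exists>p \<in> S2 L P. (u, v) \<in> interp M p \<or> (v, u) \<in> interp M p))"

definition template :: "'s set \<Rightarrow> ('s, 'v) struct set \<Rightarrow> ('s, 'v) pattern \<Rightarrow> bool" where
  "template L P M \<longleftrightarrow> complete L P M \<and>
     (\<forall>p \<in> S2 L P. \<forall>u \<in> univ M. (u, u) \<notin> interp M p) \<and>
     (\<forall>p \<in> S2 L P. \<forall>p' \<in> S2 L P. \<forall>\<mu>. \<mu> permutes {1, 2} \<and> p = rename id \<mu> ` p' \<longrightarrow>
        (\<forall>a. a 1 \<in> univ M \<and> a 2 \<in> univ M \<and> a 1 \<noteq> a 2 \<longrightarrow>
           ((a 1, a 2) \<in> interp M p \<longleftrightarrow> (a (\<mu> 1), a (\<mu> 2)) \<in> interp M p')))"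

definition Ch :: "'s set \<Rightarrow> ('s, 'v) struct set \<Rightarrow> ('s, 'v) pattern \<Rightarrow> 'v set \<Rightarrow> ('s, 'v) qf set set"
  where "Ch L P M A =
    {inst p a b | p a b. p \<in> S2 L P \<and> inst p a b \<in> S2_consts L P (univ M) \<and>
       {a, b} = A \<and> (a, b) \<in> interp M p}"

text \<open>The values of a choice function outside of the two-element subsets are irrelevant.\<close>

definition choice_function ::
    "'s set \<Rightarrow> ('s, 'v) struct set \<Rightarrow> ('s, 'v) pattern \<Rightarrow> ('v set \<Rightarrow> ('s, 'v) qf set) \<Rightarrow> bool" where
  "choice_function L P M c \<longleftrightarrow> (\<forall>A \<in> nsets (univ M) 2. c A \<in> Ch L P M A)"

definition subpattern_by ::
    "'s set \<Rightarrow> ('s, 'v) struct \<Rightarrow> ('v set \<Rightarrow> ('s, 'v) qf set) \<Rightarrow> ('s, 'v) pattern \<Rightarrow> bool" where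
  "subpattern_by L N c M \<longleftrightarrow> is_structure L N \<and> univ N = univ M \<and>
     (\<forall>A \<in> nsets (univ M) 2. Diag L N A = c A)"

definition full_subpattern ::
    "'s set \<Rightarrow> ('s, 'v) struct set \<Rightarrow> ('s, 'v) struct \<Rightarrow> ('s, 'v) pattern \<Rightarrow> bool" where
  "full_subpattern L P N M \<longleftrightarrow> (\<exists>c. choice_function L P M c \<and> subpattern_by L N c M)"

definition sub :: "'s set \<Rightarrow> ('s, 'v) struct set \<Rightarrow> ('s, 'v) pattern \<Rightarrow> nat" where
  "sub L P M = card {N. full_subpattern L P N M}"

definition random :: "'s set \<Rightarrow> ('s, 'v) struct set \<Rightarrow> ('s, 'v) pattern \<Rightarrow> bool" where
  "random L P M \<longleftrightarrow> complete L P M \<and>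
     (\<forall>c. choice_function L P M c \<longrightarrow> (\<exists>N\<in>P. subpattern_by L N c M))"

definition random_templates ::
    "'s set \<Rightarrow> ('s, 'v) struct set \<Rightarrow> nat \<Rightarrow> ('s, 'v) pattern set" where
  "random_templates L P n =
     {M. template L P M \<and> random L P M \<and> finite (univ M) \<and> card (univ M) = n}"

definition ex_number :: "'s set \<Rightarrow> ('s, 'v) struct set \<Rightarrow> nat \<Rightarrow> nat" where
  "ex_number L P n = Max {sub L P M | M. M \<in> random_templates L P n}"

definition extremal_templates ::
    "'s set \<Rightarrow> ('s, 'v) struct set \<Rightarrow> nat \<Rightarrow> ('s, 'v) pattern set" where
  "extremal_templates L P n = {M \<in> random_templates L P n. sub L P M = ex_number L P n}"

text \<open>
  The parameter \<open>L\<close> of closeness is the language of \<open>M\<close> and \<open>M'\<close>.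
\<close>

definition close :: "'s set \<Rightarrow> real \<Rightarrow> ('s, 'v) struct \<Rightarrow> ('s, 'v) struct \<Rightarrow> bool" where
  "close L \<delta> M M' \<longleftrightarrow> univ M = univ M' \<and>
     real (card {A \<in> nsets (univ M) 2. \<exists>a. {a 1, a 2} = A \<and> qf_type L M a \<noteq> qf_type L M' a})
       \<le> \<delta> * real (card (univ M) choose 2)"

definition has_stability_theorem :: "'s set \<Rightarrow> ('s, 'v) struct set \<Rightarrow> bool" where
  "has_stability_theorem L P \<longleftrightarrow>
     (\<forall>\<delta>>0. \<exists>\<epsilon>>0. \<exists>n0. \<forall>n>n0. \<forall>M \<in> random_templates L P n.
        real (sub L P M) \<ge> real (ex_number L P n) powr (1 - \<epsilon>) \<longrightarrow>
        (\<exists>M' \<in> extremal_templates L P n. close (S2 L P) \<delta> M M'))"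

definition metric_lang :: "nat \<Rightarrow> nat set" where
  "metric_lang r = {1..r}"

definition metric_struct :: "nat \<Rightarrow> 'v set \<Rightarrow> ('v \<Rightarrow> 'v \<Rightarrow> real) \<Rightarrow> (nat, 'v) struct" where
  "metric_struct r V d =
     Struct V (\<lambda>i. {(x, y). i \<in> metric_lang r \<and> x \<in> V \<and> y \<in> V \<and> d x y = real i})"

definition metric_property :: "nat \<Rightarrow> (nat, 'v) struct set" where
  "metric_property r =
     {N. is_structure (metric_lang r) N \<and>
         (\<exists>n d. Metric_space {1..n::nat} d \<and>
            (\<forall>x\<in>{1..n}. \<forall>y\<in>{1..n}. x \<noteq> y \<longrightarrow> d x y \<in> real ` {1..r}) \<and>
            isomorphic (metric_lang r) N (metric_struct r {1..n} d))}"

end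

theory Submission
  imports Defs
begin

text \<open>
  Write \<open>r = 2q + 1\<close>. A random template is the same thing as a colouring that gives every pair of
  points a nonempty set of distances from \<open>{1..r}\<close> in such a way that every choice of one distance per
  pair satisfies the triangle inequality, and its number of full subpatterns is the product of the
  sizes of these sets. Giving all pairs the set \<open>{q..2q}\<close>, or all pairs the set \<open>{q+1..2q+1}\<close>, yields
  the same product \<open>(q + 1) ^ (n choose 2)\<close>. But the two are not on a par: in the second
  colouring the pairs of a perfect matching may be enlarged to \<open>{q..2q+1}\<close>, whereas the first one,
  and everything close to it, leaves no room for such a gain. So the first template is almost
  extremal without being close to an extremal one.

  The quantitative core is \<open>prod_card_colouring_le\<close>. Call a pair large if its set has more than
  \<open>q + 1\<close> elements. If \<open>{u, v}\<close> is large and \<open>w\<close> is a third point, then the sets of \<open>{u, w}\<close> and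
  \<open>{v, w}\<close> have together at most \<open>2(q + 1)\<close> elements, and they are not both \<open>{q..2q}\<close>
  (\<open>large_pair\<close>). Removing large pairs with their endpoints one after the other, say \<open>t\<close> times, bounds
  the product by \<open>(q + 1) ^ (n choose 2) * r ^ t\<close> and produces at least \<open>t (n - t)\<close> pairs whose set
  is not \<open>{q..2q}\<close>. As \<open>2t \<le> n\<close>, the extremal number exceeds \<open>(q + 1) ^ (n choose 2)\<close> at most by the
  factor \<open>r ^ (n / 2)\<close>, which is negligible in the exponent. If on the other hand all but
  \<open>\<delta> (n choose 2)\<close> pairs have the set \<open>{q..2q}\<close>, then \<open>t\<close> is at most about \<open>\<delta> n\<close>, and for small \<open>\<delta>\<close> the
  factor \<open>r ^ t\<close> is smaller than the factor \<open>((q + 2) / (q + 1)) ^ (n / 2)\<close> that the matching gains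
  (\<open>matching_gain\<close>).
\<close>

section \<open>Products over pairs\<close>

lemma (in comm_monoid_set) pairs_insert:
  assumes "finite V" "x \<notin> V"
  shows "F g (nsets (insert x V) 2) = F (\<lambda>y. g {x, y}) V \<^bold>* F g (nsets V 2)"
proof -
  have eq: "nsets (insert x V) 2 = (\<lambda>y. {x, y}) ` V \<union> nsets V 2"
    using assms by (force elim!: nsets2_E)
  have "inj_on (\<lambda>y. {x, y}) V"
    by (auto simp: inj_on_def doubleton_eq_iff)
  moreover have "(\<lambda>y. {x, y}) ` V \<inter> nsets V 2 = {}"
    using assms by auto
  ultimately show ?thesis
    unfolding eq using assms by (simp add: union_disjoint finite_imp_finite_nsets reindex)
qed

lemma (in comm_monoid_set) pairs_insert_two:
  assumes "finite V" "u \<notin> V" "v \<notin> V" "u \<noteq> v"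
  shows "F g (nsets (insert u (insert v V)) 2) =
    g {u, v} \<^bold>* F (\<lambda>w. g {u, w} \<^bold>* g {v, w}) V \<^bold>* F g (nsets V 2)"
  using assms by (simp add: pairs_insert distrib assoc)

lemma card_pairs: "finite V \<Longrightarrow> card (nsets V 2) = card V choose 2"
  by (simp add: card_nsets)

section \<open>Colourings of pairs by sets of distances\<close>

text \<open>
  For one-element sets \<open>S A = {c A}\<close> the condition says that \<open>c\<close> is a metric with distances
  in \<open>{1..r}\<close>.
\<close>

definition metric_colouring :: "nat \<Rightarrow> 'v set \<Rightarrow> ('v set \<Rightarrow> nat set) \<Rightarrow> bool" where
  "metric_colouring r V S \<longleftrightarrow>
     (\<forall>A \<in> nsets V 2. S A \<noteq> {} \<and> S A \<subseteq> {1..r}) \<and>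
     (\<forall>u\<in>V. \<forall>v\<in>V. \<forall>w\<in>V. u \<noteq> v \<and> v \<noteq> w \<and> u \<noteq> w \<longrightarrow>
        (\<forall>i \<in> S {u, v}. \<forall>j \<in> S {v, w}. \<forall>l \<in> S {u, w}. l \<le> i + j))"

lemma metric_colouringD:
  assumes "metric_colouring r V S" "u \<in> V" "v \<in> V" "u \<noteq> v"
  shows "S {u, v} \<noteq> {}" "S {u, v} \<subseteq> {1..r}" "finite (S {u, v})"
proof -
  have "{u, v} \<in> nsets V 2" using assms by simp
  then show ne: "S {u, v} \<noteq> {}" and sub: "S {u, v} \<subseteq> {1..r}"
    using assms(1) by (auto simp: metric_colouring_def)
  show "finite (S {u, v})" by (rule finite_subset[OF sub]) simp
qed

lemma metric_colouring_subset:
  "metric_colouring r V S \<Longrightarrow> W \<subseteq> V \<Longrightarrow> metric_colouring r W S"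
  unfolding metric_colouring_def using nsets_mono[of W V 2] by (meson subset_iff)

lemma card_plus_Min_le_Max:
  fixes X :: "nat set"
  assumes "finite X" "X \<noteq> {}"
  shows "card X + Min X \<le> Suc (Max X)"
proof -
  have "X \<subseteq> {Min X..Max X}" using assms by auto
  from card_mono[OF _ this] have "card X \<le> Suc (Max X) - Min X" by simp
  moreover have "Min X \<le> Max X" using assms by simp
  ultimately show ?thesis by linarith
qed

lemma metric_colouring_triangle:
  assumes S: "metric_colouring r V S"
    and V: "u \<in> V" "v \<in> V" "w \<in> V" "u \<noteq> v" "v \<noteq> w" "u \<noteq> w"
  shows "Max (S {u, w}) \<le> Min (S {u, v}) + Min (S {v, w})"
proof -
  have "Max (S {u, w}) \<in> S {u, w}" "Min (S {u, v}) \<in> S {u, v}" "Min (S {v, w}) \<in> S {v, w}"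
    using metric_colouringD[OF S] V by auto
  with S V show ?thesis unfolding metric_colouring_def by blast
qed

text \<open>
  A large pair \<open>{u, v}\<close> contains a distance of at most \<open>q\<close>, since no distance exceeds \<open>2q + 1\<close>. As the
  distances of \<open>w\<close> to \<open>u\<close> and to \<open>v\<close> can differ by no more than that, their sets cannot both be wide.
  If both were \<open>{q..2q}\<close>, then \<open>{u, v}\<close> would be confined to \<open>{q..2q}\<close> as well: the least distance to
  \<open>u\<close> and the greatest one to \<open>v\<close> force it to be at least \<open>q\<close>, and the two least ones to be at most \<open>2q\<close>.
\<close>

lemma large_pair:
  assumes S: "metric_colouring (2 * q + 1) V S"
    and V: "u \<in> V" "v \<in> V" "w \<in> V" "u \<noteq> v" "v \<noteq> w" "u \<noteq> w"
    and large: "card (S {u, v}) > q + 1"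
  shows "card (S {u, w}) * card (S {v, w}) \<le> (q + 1) * (q + 1)"
    and "S {u, w} \<noteq> {q..2*q} \<or> S {v, w} \<noteq> {q..2*q}"
proof -
  have size: "card (S {a, b}) + Min (S {a, b}) \<le> Suc (Max (S {a, b}))"
    if "a \<in> V" "b \<in> V" "a \<noteq> b" for a b
    using metric_colouringD[OF S] that by (intro card_plus_Min_le_Max) auto
  note sizes = size[OF V(1,2,4)] size[OF V(1,3,6)] size[OF V(2,3,5)]
  have "Max (S {u, v}) \<in> S {u, v}"
    using metric_colouringD[OF S] V by simp
  then have max: "Max (S {u, v}) \<le> 2 * q + 1"
    using metric_colouringD(2)[OF S V(1,2,4)] by auto
  have t1: "Max (S {u, w}) \<le> Min (S {u, v}) + Min (S {v, w})"
    by (rule metric_colouring_triangle[OF S]) (use V in auto)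
  have t2: "Max (S {v, w}) \<le> Min (S {u, v}) + Min (S {u, w})"
    using metric_colouring_triangle[OF S, of v u w] V by (simp add: insert_commute)
  have t3: "Max (S {u, v}) \<le> Min (S {u, w}) + Min (S {v, w})"
    using metric_colouring_triangle[OF S, of u w v] V by (simp add: insert_commute)
  have "Min (S {u, v}) \<le> q"
    using sizes(1) max large by linarith
  moreover have "card (S {u, w}) + card (S {v, w}) \<le> 2 * Min (S {u, v}) + 2"
    using sizes(2,3) t1 t2 by linarith
  ultimately have sum: "card (S {u, w}) + card (S {v, w}) \<le> 2 * (q + 1)"
    by simp
  have "4 * (card (S {u, w}) * card (S {v, w})) \<le> (card (S {u, w}) + card (S {v, w}))\<^sup>2"
    using sum_squares_bound[of "real (card (S {u, w}))" "real (card (S {v, w}))"]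
    by (simp add: power2_sum flip: of_nat_le_iff [where 'a = real])
  also have "\<dots> \<le> (2 * (q + 1))\<^sup>2"
    using sum by (rule power_mono) simp
  finally show "card (S {u, w}) * card (S {v, w}) \<le> (q + 1) * (q + 1)"
    by (simp add: power2_eq_square)
  show "S {u, w} \<noteq> {q..2*q} \<or> S {v, w} \<noteq> {q..2*q}"
  proof (rule ccontr)
    assume "\<not> ?thesis"
    then have *: "S {u, w} = {q..2*q}" "S {v, w} = {q..2*q}" by auto
    have "Max {q..2*q} = 2*q" "Min {q..2*q} = q"
      by (auto intro!: Max_eqI Min_eqI)
    with * t1 t2 t3 sizes(1) large show False by simp
  qed
qed

text \<open>
  Induction on the number of points: remove both endpoints of a large pair. The pairs between them
  and the other \<open>n - 2\<close> points contribute at most \<open>(q + 1)\<^sup>2\<close> per point, so that the only loss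
  against \<open>(q + 1) ^ (n choose 2)\<close> is at most the factor \<open>r\<close> for the large pair itself. Every removal
  also uncovers a pair with a set other than \<open>{q..2q}\<close> at each of the \<open>n - 2\<close> points, besides the
  large pair; the numbers \<open>n - 1\<close>, \<open>n - 3\<close>, \<dots> add up to \<open>t (n - t)\<close>.
\<close>

lemma prod_card_colouring_le:
  assumes "finite V" "metric_colouring (2 * q + 1) V S"
  shows "\<exists>t. 2 * t \<le> card V \<and>
    (\<Prod>A\<in>nsets V 2. card (S A)) \<le> (q + 1) ^ (card V choose 2) * (2 * q + 1) ^ t \<and>
    t * (card V - t) \<le> (\<Sum>A\<in>nsets V 2. of_bool (S A \<noteq> {q..2*q}))"
  using assms
proof (induction "card V" arbitrary: V rule: less_induct)
  case less
  show ?case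
  proof (cases "\<exists>A\<in>nsets V 2. card (S A) > q + 1")
    case False
    then have "(\<Prod>A\<in>nsets V 2. card (S A)) \<le> (\<Prod>A\<in>nsets V 2. q + 1)"
      by (intro prod_mono) (auto simp: not_less)
    then show ?thesis
      using less.prems by (intro exI[of _ 0]) (simp add: card_pairs)
  next
    case True
    then obtain u v where uv: "u \<in> V" "v \<in> V" "u \<noteq> v" "card (S {u, v}) > q + 1"
      by (auto elim!: nsets2_E)
    define W where "W = V - {u, v}"
    have V: "V = insert u (insert v W)" and uvW: "u \<notin> W" "v \<notin> W"
      using uv by (auto simp: W_def)
    have finW: "finite W" using less.prems W_def by simp
    have cV: "card V = card W + 2" using V uvW uv finW by simp
    obtain t where t: "2 * t \<le> card W"
      "(\<Prod>A\<in>nsets W 2. card (S A)) \<le> (q + 1) ^ (card W choose 2) * (2 * q + 1) ^ t"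
      "t * (card W - t) \<le> (\<Sum>A\<in>nsets W 2. of_bool (S A \<noteq> {q..2*q}))"
      using less.hyps[of W] finW cV metric_colouring_subset[OF less.prems(2), of W] W_def by auto
    note large = large_pair[OF less.prems(2) uv(1,2) _ uv(3) _ _ uv(4)]
    have "S {u, v} \<subseteq> {1..2*q+1}"
      using less.prems(2) uv unfolding metric_colouring_def by simp
    from card_mono[OF _ this] have le_r: "card (S {u, v}) \<le> 2 * q + 1" by simp
    have "(\<Prod>w\<in>W. card (S {u, w}) * card (S {v, w})) \<le> (\<Prod>w\<in>W. (q + 1) * (q + 1))"
      by (intro prod_mono conjI large(1)) (auto simp: W_def)
    also have "\<dots> = (q + 1) ^ (2 * card W)"
      by (simp add: power_mult power2_eq_square)
    finally have star: "(\<Prod>w\<in>W. card (S {u, w}) * card (S {v, w})) \<le> (q + 1) ^ (2 * card W)" .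
    have "(\<Prod>A\<in>nsets V 2. card (S A))
        = card (S {u, v}) * (\<Prod>w\<in>W. card (S {u, w}) * card (S {v, w})) * (\<Prod>A\<in>nsets W 2. card (S A))"
      unfolding V using finW uvW uv by (simp add: prod.pairs_insert_two del: prod.distrib)
    also have "\<dots> \<le> (2*q+1) * (q + 1) ^ (2 * card W) * ((q + 1) ^ (card W choose 2) * (2 * q + 1) ^ t)"
      by (intro mult_mono le_r star t(2)) auto
    also have "\<dots> = (q + 1) ^ (2 * card W + (card W choose 2)) * (2*q+1) ^ (Suc t)"
      by (simp only: power_add power_Suc mult_ac)
    also have "\<dots> \<le> (q + 1) ^ (card V choose 2) * (2*q+1) ^ (Suc t)"
    proof -
      have "card V choose 2 = 1 + 2 * card W + (card W choose 2)"
        unfolding cV by (simp add: numeral_2_eq_2)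
      then show ?thesis by (intro mult_right_mono power_increasing) auto
    qed
    finally have prod: "(\<Prod>A\<in>nsets V 2. card (S A)) \<le> \<dots>" .
    let ?b = "\<lambda>A. of_bool (S A \<noteq> {q..2*q}) :: nat"
    have "card {q..2*q} = q + 1" by simp
    then have 1: "?b {u, v} = 1" using uv(4) by auto
    have "(\<Sum>w\<in>W. 1) \<le> (\<Sum>w\<in>W. ?b {u, w} + ?b {v, w})"
    proof (rule sum_mono)
      fix w assume "w \<in> W"
      then have "S {u, w} \<noteq> {q..2*q} \<or> S {v, w} \<noteq> {q..2*q}"
        by (intro large(2)) (auto simp: W_def)
      then show "1 \<le> ?b {u, w} + ?b {v, w}" by auto
    qed
    then have 2: "card W \<le> (\<Sum>w\<in>W. ?b {u, w} + ?b {v, w})" by simp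
    have "(\<Sum>A\<in>nsets V 2. ?b A) = ?b {u, v} + (\<Sum>w\<in>W. ?b {u, w} + ?b {v, w}) + (\<Sum>A\<in>nsets W 2. ?b A)"
      unfolding V using finW uvW uv by (intro sum.pairs_insert_two)
    then have "(\<Sum>A\<in>nsets V 2. ?b A) \<ge> 1 + card W + t * (card W - t)"
      using 1 2 t(3) by linarith
    moreover have "1 + card W + t * (card W - t) = Suc t * (card V - Suc t)"
    proof -
      obtain m where "card W = t + m" using t(1) by (metis le_add1 mult_2 le_trans le_iff_add)
      then show ?thesis by (simp add: cV)
    qed
    ultimately show ?thesis
      using t(1) prod cV by (intro exI[of _ "Suc t"]) auto
  qed
qed

section \<open>Diagrams\<close>

lemma sat_cong:
  assumes "\<phi> \<in> qf_formulas L T"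
    and "\<And>s t. s \<in> T \<Longrightarrow> t \<in> T \<Longrightarrow> e s = e t \<longleftrightarrow> e' s = e' t"
    and "\<And>s t R. s \<in> T \<Longrightarrow> t \<in> T \<Longrightarrow> R \<in> L \<Longrightarrow> (e s, e t) \<in> interp N R \<longleftrightarrow> (e' s, e' t) \<in> interp N' R"
  shows "sat N e \<phi> \<longleftrightarrow> sat N' e' \<phi>"
  using assms(1) by (induction \<phi>) (auto simp: qf_formulas_def assms(2,3))

lemma sat_rename: "sat N e (rename id g \<phi>) \<longleftrightarrow> sat N (e \<circ> g) \<phi>"
  by (induction \<phi>) auto

text \<open>
  The constants name themselves, so that diagrams on the same set can only differ in atoms.
\<close>

lemma Diag_eq_iff:
  "Diag L N A = Diag L N' A \<longleftrightarrow>
    (\<forall>x\<in>A. \<forall>y\<in>A. \<forall>R\<in>L. (x, y) \<in> interp N R \<longleftrightarrow> (x, y) \<in> interp N' R)"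
proof
  assume eq: "Diag L N A = Diag L N' A"
  have "Rel R x y \<in> Diag L N'' A \<longleftrightarrow> (x, y) \<in> interp N'' R"
    if "x \<in> A" "y \<in> A" "R \<in> L" for x y R and N'' :: "('a, 'b) struct"
    using that by (simp add: Diag_def qf_formulas_def)
  with eq show "\<forall>x\<in>A. \<forall>y\<in>A. \<forall>R\<in>L. (x, y) \<in> interp N R \<longleftrightarrow> (x, y) \<in> interp N' R"
    by metis
next
  assume "\<forall>x\<in>A. \<forall>y\<in>A. \<forall>R\<in>L. (x, y) \<in> interp N R \<longleftrightarrow> (x, y) \<in> interp N' R"
  then show "Diag L N A = Diag L N' A"
    unfolding Diag_def by (intro Collect_cong conj_cong refl sat_cong) auto
qed

lemma rename_qf_formulas:
  "\<phi> \<in> qf_formulas L A \<Longrightarrow> g ` A \<subseteq> B \<Longrightarrow> rename id g \<phi> \<in> qf_formulas L B"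
  by (auto simp: qf_formulas_def qf.set_map)

text \<open>
  This serves to instantiate types at a pair of points, and to see that permuting the variables of
  a type is harmless when the distance is symmetric.
\<close>

lemma rename_Diag:
  assumes g: "bij_betw g A B"
    and atoms: "\<And>x y R. x \<in> A \<Longrightarrow> y \<in> A \<Longrightarrow> R \<in> L \<Longrightarrow>
      (x, y) \<in> interp N R \<longleftrightarrow> (g x, g y) \<in> interp N' R"
  shows "rename id g ` Diag L N A = Diag L N' B"
proof -
  have gA: "g ` A = B" and inj: "inj_on g A" using g by (auto simp: bij_betw_def)
  have sat: "sat N' id (rename id g \<phi>) \<longleftrightarrow> sat N id \<phi>" if "\<phi> \<in> qf_formulas L A" for \<phi>
    unfolding sat_rename using that atoms inj by (intro sat_cong) (auto simp: inj_on_eq_iff)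
  show ?thesis
  proof
    show "rename id g ` Diag L N A \<subseteq> Diag L N' B"
      using sat rename_qf_formulas gA by (fastforce simp: Diag_def)
  next
    show "Diag L N' B \<subseteq> rename id g ` Diag L N A"
    proof
      fix \<psi> assume \<psi>: "\<psi> \<in> Diag L N' B"
      define \<phi> where "\<phi> = rename id (inv_into A g) \<psi>"
      have mem: "\<phi> \<in> qf_formulas L A"
        unfolding \<phi>_def using \<psi> gA
        by (intro rename_qf_formulas[of _ _ B]) (auto simp: Diag_def intro: inv_into_into)
      have "rename id g \<phi> = rename id id \<psi>"
        unfolding \<phi>_def qf.map_comp using \<psi> gA
        by (intro qf.map_cong refl) (auto simp: Diag_def qf_formulas_def f_inv_into_f)
      then have eq: "rename id g \<phi> = \<psi>" by (simp add: qf.map_id)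
      with \<psi> sat[OF mem] mem show "\<psi> \<in> rename id g ` Diag L N A"
        by (auto simp: Diag_def intro!: image_eqI[of _ _ \<phi>])
    qed
  qed
qed

section \<open>Metric spaces as structures\<close>

definition dist_struct :: "nat \<Rightarrow> 'v set \<Rightarrow> ('v set \<Rightarrow> nat) \<Rightarrow> (nat, 'v) struct" where
  "dist_struct r V c =
     Struct V (\<lambda>i. {(x, y). i \<in> metric_lang r \<and> x \<in> V \<and> y \<in> V \<and> x \<noteq> y \<and> c {x, y} = i})"

lemma univ_dist_struct [simp]: "univ (dist_struct r V c) = V"
  by (simp add: dist_struct_def)

lemma interp_dist_struct [simp]:
  "(x, y) \<in> interp (dist_struct r V c) i \<longleftrightarrow>
     i \<in> metric_lang r \<and> x \<in> V \<and> y \<in> V \<and> x \<noteq> y \<and> c {x, y} = i"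
  by (simp add: dist_struct_def)

lemma is_structure_dist_struct: "is_structure (metric_lang r) (dist_struct r V c)"
  by (auto simp: is_structure_def)

lemma dist_struct_in_metric_property:
  assumes "finite V" "metric_colouring r V (\<lambda>A. {c A})"
  shows "dist_struct r V c \<in> metric_property r"
proof -
  obtain f where f: "bij_betw f V {1..card V}"
    using ex_bij_betw_nat_finite_1[OF assms(1)] bij_betw_inv by blast
  define g where "g = inv_into V f"
  have g: "bij_betw g {1..card V} V"
    unfolding g_def by (rule bij_betw_inv_into[OF f])
  have gV: "g x \<in> V" if "x \<in> {1..card V}" for x
    using g that by (auto simp: bij_betw_def)
  have ginj: "g x = g y \<longleftrightarrow> x = y" if "x \<in> {1..card V}" "y \<in> {1..card V}" for x y
    using g that by (metis bij_betw_imp_inj_on inj_on_eq_iff)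
  have gf: "g (f x) = x" if "x \<in> V" for x
    using f that by (simp add: g_def bij_betw_def)
  have fV: "f x \<in> {1..card V}" if "x \<in> V" for x
    using f that by (auto simp: bij_betw_def)
  define d where "d x y = (if x = y then 0 else real (c {g x, g y}))" for x y
  have c: "c {x, y} \<in> {1..r}" if "x \<in> V" "y \<in> V" "x \<noteq> y" for x y
    using assms(2) that unfolding metric_colouring_def
    by (metis doubleton_in_nsets_2 insert_subset)
  have tri: "c {u, w} \<le> c {u, v} + c {v, w}"
    if "u \<in> V" "v \<in> V" "w \<in> V" "u \<noteq> v" "v \<noteq> w" "u \<noteq> w" for u v w
    using assms(2) that unfolding metric_colouring_def by blast
  have dpos: "d x y \<in> real ` {1..r}" if "x \<in> {1..card V}" "y \<in> {1..card V}" "x \<noteq> y" for x y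
    using c[of "g x" "g y"] that gV ginj by (simp add: d_def)
  have ms: "Metric_space {1..card V} d"
  proof
    show "0 \<le> d x y" for x y by (simp add: d_def)
    show "d x y = d y x" for x y by (simp add: d_def insert_commute)
    show "d x y = 0 \<longleftrightarrow> x = y" if "x \<in> {1..card V}" "y \<in> {1..card V}" for x y
      using dpos[OF that] by (force simp: d_def)
    show "d x z \<le> d x y + d y z"
      if "x \<in> {1..card V}" "y \<in> {1..card V}" "z \<in> {1..card V}" for x y z
    proof (cases "x = y \<or> y = z \<or> x = z")
      case False
      then have "c {g x, g z} \<le> c {g x, g y} + c {g y, g z}"
        using that by (intro tri) (auto simp: gV ginj)
      with False show ?thesis by (simp add: d_def flip: of_nat_add)
    qed (auto simp: d_def)
  qed
  have "isomorphic (metric_lang r) (dist_struct r V c) (metric_struct r {1..card V} d)"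
    unfolding isomorphic_def
  proof (intro exI conjI ballI)
    show "bij_betw f (univ (dist_struct r V c)) (univ (metric_struct r {1..card V} d))"
      using f by (simp add: metric_struct_def)
  next
    fix i x y assume i: "i \<in> metric_lang r" and "x \<in> univ (dist_struct r V c)" "y \<in> univ (dist_struct r V c)"
    then have x: "x \<in> V" and y: "y \<in> V" by auto
    have "f x = f y \<longleftrightarrow> x = y" using gf x y by metis
    with i x y show "(x, y) \<in> interp (dist_struct r V c) i \<longleftrightarrow>
        (f x, f y) \<in> interp (metric_struct r {1..card V} d) i"
      using fV[OF x] fV[OF y] by (auto simp: metric_struct_def d_def gf metric_lang_def)
  qed
  with ms dpos show ?thesis
    unfolding metric_property_def by (blast intro: is_structure_dist_struct)
qed

text \<open>
  Up to isomorphism the members of the property live on \<open>{1..n}\<close>;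
  here their metric is transported back, so that isomorphisms disappear from the rest of the proof.
\<close>

lemma metric_property_distances:
  assumes "N \<in> metric_property r"
  obtains c where "N = dist_struct r (univ N) c" "metric_colouring r (univ N) (\<lambda>A. {c A})"
proof -
  obtain n d f where str: "is_structure (metric_lang r) N"
    and ms: "Metric_space {1..n::nat} d"
    and d: "\<forall>x\<in>{1..n}. \<forall>y\<in>{1..n}. x \<noteq> y \<longrightarrow> d x y \<in> real ` {1..r}"
    and f: "bij_betw f (univ N) {1..n}"
    and iso: "\<forall>i\<in>metric_lang r. \<forall>x\<in>univ N. \<forall>y\<in>univ N.
      (x, y) \<in> interp N i \<longleftrightarrow> (f x, f y) \<in> interp (metric_struct r {1..n} d) i"
    using assms by (auto simp: metric_property_def isomorphic_def metric_struct_def)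
  interpret Metric_space "{1..n}" d by (rule ms)
  have fV: "f x \<in> {1..n}" if "x \<in> univ N" for x
    using f that by (auto simp: bij_betw_def)
  have finj: "f x = f y \<longleftrightarrow> x = y" if "x \<in> univ N" "y \<in> univ N" for x y
    using f that by (metis bij_betw_imp_inj_on inj_on_eq_iff)
  \<comment> \<open>well defined on pairs because \<open>d\<close> is symmetric\<close>
  define c where "c A = (SOME i. \<exists>x y. A = {x, y} \<and> x \<in> univ N \<and> y \<in> univ N \<and> real i = d (f x) (f y))" for A
  have c: "real (c {x, y}) = d (f x) (f y)" if "x \<in> univ N" "y \<in> univ N" "x \<noteq> y" for x y
  proof -
    have "d (f x) (f y) \<in> real ` {1..r}"
      using d fV finj that by simp
    then obtain i where "real i = d (f x) (f y)" by auto
    then have "\<exists>i x' y'. {x, y} = {x', y'} \<and> x' \<in> univ N \<and> y' \<in> univ N \<and> real i = d (f x') (f y')"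
      using that by blast
    then have "\<exists>x' y'. {x, y} = {x', y'} \<and> x' \<in> univ N \<and> y' \<in> univ N \<and> real (c {x, y}) = d (f x') (f y')"
      unfolding c_def by (rule someI_ex)
    then obtain x' y' where "{x, y} = {x', y'}" "real (c {x, y}) = d (f x') (f y')" by blast
    then show ?thesis
      using commute[of "f x" "f y"] by (auto simp: doubleton_eq_iff)
  qed
  have cr: "c {x, y} \<in> {1..r}" if "x \<in> univ N" "y \<in> univ N" "x \<noteq> y" for x y
  proof -
    have "d (f x) (f y) \<in> real ` {1..r}"
      using d fV finj that by simp
    then have "real (c {x, y}) \<in> real ` {1..r}" using c that by simp
    then show ?thesis by auto
  qed
  have "(x, y) \<in> interp N i \<longleftrightarrow> (x, y) \<in> interp (dist_struct r (univ N) c) i" for x y i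
  proof (cases "i \<in> metric_lang r \<and> x \<in> univ N \<and> y \<in> univ N")
    case True
    then have "(x, y) \<in> interp N i \<longleftrightarrow> d (f x) (f y) = real i"
      using iso fV by (simp add: metric_struct_def)
    also have "\<dots> \<longleftrightarrow> x \<noteq> y \<and> c {x, y} = i"
    proof (cases "x = y")
      case True
      with \<open>i \<in> metric_lang r \<and> x \<in> univ N \<and> y \<in> univ N\<close> fV show ?thesis
        by (auto simp: metric_lang_def mdist_zero)
    qed (use c[of x y] True in auto)
    finally show ?thesis using True by simp
  next
    case False
    with str show ?thesis by (auto simp: is_structure_def)
  qed
  then have "interp N = interp (dist_struct r (univ N) c)"
    by (intro ext set_eqI) auto
  then have "N = dist_struct r (univ N) c"
    by (metis struct.expand univ_dist_struct)
  moreover have "metric_colouring r (univ N) (\<lambda>A. {c A})"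
    unfolding metric_colouring_def
  proof (intro conjI ballI impI)
    fix A assume "A \<in> nsets (univ N) 2"
    then show "{c A} \<noteq> {}" "{c A} \<subseteq> {1..r}" using cr by (auto elim!: nsets2_E)
  next
    fix u v w i j l
    assume V: "u \<in> univ N" "v \<in> univ N" "w \<in> univ N" "u \<noteq> v \<and> v \<noteq> w \<and> u \<noteq> w"
      and "i \<in> {c {u, v}}" "j \<in> {c {v, w}}" "l \<in> {c {u, w}}"
    then have "real l \<le> real i + real j"
      using c fV triangle[of "f u" "f v" "f w"] by simp
    then show "l \<le> i + j" by linarith
  qed
  ultimately show ?thesis by (rule that)
qed

section \<open>The types of pairs\<close>

text \<open>
  The diagram of a pair \<open>A\<close> at distance \<open>i\<close>. As it refers to the unordered pair, the types
  \<open>p(c\<^sub>u, c\<^sub>v)\<close> and \<open>p(c\<^sub>v, c\<^sub>u)\<close> become literally equal. The numbers 1 and 2, which stand for the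
  variables, are a pair as well; this yields the complete types.
\<close>

definition edge_diagram :: "nat \<Rightarrow> nat \<Rightarrow> 'v set \<Rightarrow> (nat, 'v) qf set" where
  "edge_diagram r i A = Diag (metric_lang r) (dist_struct r A (\<lambda>_. i)) A"

abbreviation dist_type :: "nat \<Rightarrow> nat \<Rightarrow> (nat, nat) qf set" where
  "dist_type r i \<equiv> edge_diagram r i {1, 2}"

lemma Diag_dist_struct:
  assumes "A \<in> nsets V 2"
  shows "Diag (metric_lang r) (dist_struct r V c) A = edge_diagram r (c A) A"
proof -
  have "x \<in> V \<and> (\<forall>y\<in>A. x \<noteq> y \<longrightarrow> {x, y} = A)" if "x \<in> A" for x
    using assms that by (auto elim!: nsets2_E)
  then show ?thesis
    unfolding edge_diagram_def Diag_eq_iff interp_dist_struct by metis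
qed

lemma edge_diagram_inj:
  assumes "edge_diagram r i A = edge_diagram r j A" "card A = 2" "i \<in> {1..r}"
  shows "i = j"
proof -
  obtain u v where A: "A = {u, v}" "u \<noteq> v" using assms(2) by (auto simp: card_2_iff)
  have "u \<in> A" "v \<in> A" "i \<in> metric_lang r"
    using A assms(3) by (auto simp: metric_lang_def)
  then have "(u, v) \<in> interp (dist_struct r A (\<lambda>_. i)) i \<longleftrightarrow> (u, v) \<in> interp (dist_struct r A (\<lambda>_. j)) i"
    by (rule assms(1)[unfolded edge_diagram_def Diag_eq_iff, rule_format])
  then show ?thesis
    using assms(3) A by (simp add: metric_lang_def)
qed

lemma rename_edge_diagram:
  "bij_betw g A B \<Longrightarrow> rename id g ` edge_diagram r i A = edge_diagram r i B"
  unfolding edge_diagram_def by (rule rename_Diag) (auto simp: bij_betw_def inj_on_eq_iff)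

lemma inst_dist_type:
  assumes "u \<noteq> v"
  shows "inst (dist_type r i) u v = edge_diagram r i {u, v}"
  unfolding inst_def by (rule rename_edge_diagram) (use assms in \<open>auto simp: bij_betw_def\<close>)

lemma realizes_complete_2_type:
  assumes "complete_2_type L p" "realizes N a p"
  shows "p = qf_type L N a"
proof -
  have "\<phi> \<in> p \<longleftrightarrow> sat N a \<phi>" if "\<phi> \<in> qf_formulas L {1, 2}" for \<phi>
    using assms that unfolding complete_2_type_def realizes_def by (metis sat.simps(3))
  moreover have "p \<subseteq> qf_formulas L {1, 2}"
    using assms(1) by (simp add: complete_2_type_def)
  ultimately show ?thesis by (auto simp: qf_type_def)
qed

lemma qf_type_dist_struct:
  assumes "a 1 \<in> V" "a 2 \<in> V" "a 1 \<noteq> a 2"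
  shows "qf_type (metric_lang r) (dist_struct r V c) a = dist_type r (c {a 1, a 2})"
proof -
  have "sat (dist_struct r V c) a \<phi> \<longleftrightarrow> sat (dist_struct r {1, 2} (\<lambda>_. c {a 1, a 2})) id \<phi>"
    if "\<phi> \<in> qf_formulas (metric_lang r) {1, 2}" for \<phi>
    using that
  proof (rule sat_cong)
    have swap: "{a 2, a 1} = {a 1, a 2}" by auto
    show "a s = a t \<longleftrightarrow> id s = id t" if "s \<in> {1, 2}" "t \<in> {1, 2}" for s t
      using that assms by auto
    show "(a s, a t) \<in> interp (dist_struct r V c) R \<longleftrightarrow>
        (id s, id t) \<in> interp (dist_struct r {1, 2} (\<lambda>_. c {a 1, a 2})) R"
      if "s \<in> {1, 2}" "t \<in> {1, 2}" for s t R
      using that assms by (elim insertE emptyE) (simp_all add: swap del: One_nat_def)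
  qed
  then show ?thesis
    unfolding qf_type_def edge_diagram_def Diag_def by blast
qed

lemma metric_colouring_doubleton: "i \<in> {1..r} \<Longrightarrow> metric_colouring r {u, v} (\<lambda>_. {i})"
  by (auto simp: metric_colouring_def)

text \<open>
  That all \<open>r\<close> types occur needs two points of the underlying type, which are available since
  it is infinite.
\<close>

lemma S2_metric:
  "S2 (metric_lang r) (metric_property r :: (nat, 'v :: infinite) struct set) = dist_type r ` {1..r}"
proof (intro equalityI subsetI)
  fix p assume "p \<in> S2 (metric_lang r) (metric_property r :: (nat, 'v) struct set)"
  then obtain N :: "(nat, 'v) struct" and a where
    p: "complete_2_type (metric_lang r) p" "Neg (Equ 1 2) \<in> p" "realizes N a p"
    and N: "N \<in> metric_property r"
    unfolding S2_def by blast
  obtain c where c: "N = dist_struct r (univ N) c" "metric_colouring r (univ N) (\<lambda>A. {c A})"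
    using N by (rule metric_property_distances)
  have a: "a 1 \<in> univ N" "a 2 \<in> univ N" "a 1 \<noteq> a 2"
    using p(2,3) by (auto simp: realizes_def)
  have "p = qf_type (metric_lang r) (dist_struct r (univ N) c) a"
    using realizes_complete_2_type[OF p(1,3)] c(1) by simp
  also have "\<dots> = dist_type r (c {a 1, a 2})"
    using a by (rule qf_type_dist_struct)
  finally show "p \<in> dist_type r ` {1..r}"
    using c(2) a unfolding metric_colouring_def by auto
next
  fix p assume "p \<in> dist_type r ` {1..r}"
  then obtain i where i: "i \<in> {1..r}" "p = dist_type r i" by blast
  obtain u v :: 'v where uv: "u \<noteq> v"
    using ex_new_if_finite[OF infinite_UNIV, of "{undefined :: 'v}"] by auto
  define a where "a k = (if k = (1::nat) then u else v)" for k
  define N where "N = dist_struct r {u, v} (\<lambda>_. i)"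
  have p: "p = qf_type (metric_lang r) N a"
    unfolding N_def i(2) using uv by (subst qf_type_dist_struct) (auto simp: a_def)
  have "N \<in> metric_property r"
    unfolding N_def by (intro dist_struct_in_metric_property metric_colouring_doubleton i) simp
  moreover have "complete_2_type (metric_lang r) p"
    unfolding p complete_2_type_def qf_type_def by (auto simp: qf_formulas_def)
  moreover have "realizes N a p"
    unfolding p realizes_def qf_type_def by (auto simp: N_def a_def)
  moreover have "Neg (Equ 1 2) \<in> p"
    unfolding p qf_type_def using uv by (auto simp: qf_formulas_def a_def)
  ultimately show "p \<in> S2 (metric_lang r) (metric_property r :: (nat, 'v) struct set)"
    unfolding S2_def by blast
qed

section \<open>Templates as colourings\<close>

definition colours :: "nat \<Rightarrow> (nat, 'v) pattern \<Rightarrow> 'v set \<Rightarrow> nat set" where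
  "colours r M A = {i \<in> {1..r}. \<exists>u v. A = {u, v} \<and> (u, v) \<in> interp M (dist_type r i)}"

lemma Ch_metric:
  fixes M :: "(nat, 'v :: infinite) pattern"
  assumes "A \<in> nsets (univ M) 2"
  shows "Ch (metric_lang r) (metric_property r) M A = (\<lambda>i. edge_diagram r i A) ` colours r M A"
    (is "?L = ?R")
proof (intro equalityI subsetI)
  fix x assume "x \<in> ?L"
  then obtain i a b where i: "i \<in> {1..r}" and x: "x = inst (dist_type r i) a b"
    and ab: "{a, b} = A" "(a, b) \<in> interp M (dist_type r i)"
    unfolding Ch_def S2_metric by blast
  have "a \<noteq> b" using assms unfolding ab(1)[symmetric] by simp
  have "x = edge_diagram r i A" unfolding x inst_dist_type[OF \<open>a \<noteq> b\<close>] ab(1) by (rule refl)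
  moreover have "i \<in> colours r M A" using i ab unfolding colours_def by blast
  ultimately show "x \<in> ?R" by blast
next
  fix x assume "x \<in> ?R"
  then obtain i a b where i: "i \<in> {1..r}" and x: "x = edge_diagram r i A"
    and ab: "A = {a, b}" "(a, b) \<in> interp M (dist_type r i)"
    unfolding colours_def by blast
  have univ: "a \<in> univ M" "b \<in> univ M" "a \<noteq> b" using assms ab by auto
  have x: "x = inst (dist_type r i) a b"
    unfolding x inst_dist_type[OF univ(3)] ab(1) by (rule refl)
  have p: "dist_type r i \<in> S2 (metric_lang r) (metric_property r :: (nat, 'v) struct set)"
    unfolding S2_metric using i by blast
  then have "x \<in> S2_consts (metric_lang r) (metric_property r :: (nat, 'v) struct set) (univ M)"
    unfolding S2_consts_def x using univ by blast
  then show "x \<in> ?L"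
    unfolding Ch_def x using p ab by blast
qed

lemma colours_nonempty:
  fixes M :: "(nat, 'v :: infinite) pattern"
  assumes "complete (metric_lang r) (metric_property r) M" "A \<in> nsets (univ M) 2"
  shows "colours r M A \<noteq> {}"
proof -
  obtain u v where A: "A = {u, v}" using assms(2) by (auto elim: nsets2_E)
  then obtain i where "i \<in> {1..r}" "(u, v) \<in> interp M (dist_type r i) \<or> (v, u) \<in> interp M (dist_type r i)"
    using assms unfolding complete_def S2_metric by blast
  moreover have "A = {v, u}" using A by (simp add: insert_commute)
  ultimately have "i \<in> colours r M A" using A unfolding colours_def by blast
  then show ?thesis by blast
qed

lemma choice_function_metric_iff:
  fixes M :: "(nat, 'v :: infinite) pattern"
  shows "choice_function (metric_lang r) (metric_property r) M \<phi> \<longleftrightarrow>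
    (\<exists>c \<in> PiE (nsets (univ M) 2) (colours r M). \<forall>A \<in> nsets (univ M) 2. \<phi> A = edge_diagram r (c A) A)"
    (is "?L \<longleftrightarrow> ?R")
proof
  assume ?L
  then have "\<forall>A\<in>nsets (univ M) 2. \<exists>i \<in> colours r M A. \<phi> A = edge_diagram r i A"
    by (auto simp: choice_function_def Ch_metric)
  then obtain c where "\<forall>A\<in>nsets (univ M) 2. c A \<in> colours r M A \<and> \<phi> A = edge_diagram r (c A) A"
    unfolding bchoice_iff Bex_def by blast
  then show ?R by (intro bexI[of _ "restrict c (nsets (univ M) 2)"]) auto
next
  assume ?R
  then show ?L unfolding choice_function_def by (auto simp: Ch_metric)
qed

text \<open>
  With a single point there would be no pair whose diagram excludes loops, so \<open>N\<close> would not be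
  determined; hence the assumption on the cardinality.
\<close>

lemma subpattern_by_metric_iff:
  assumes \<phi>: "\<forall>A \<in> nsets (univ M) 2. \<phi> A = edge_diagram r (c A) A"
    and V: "card (univ M) \<ge> 2"
  shows "subpattern_by (metric_lang r) N \<phi> M \<longleftrightarrow> N = dist_struct r (univ M) c"
proof
  assume "subpattern_by (metric_lang r) N \<phi> M"
  then have str: "is_structure (metric_lang r) N" and univ: "univ N = univ M"
    and diag: "\<forall>A \<in> nsets (univ M) 2. Diag (metric_lang r) N A = edge_diagram r (c A) A"
    using \<phi> by (auto simp: subpattern_by_def)
  let ?N = "dist_struct r (univ M) c"
  have atoms: "(x, y) \<in> interp N i \<longleftrightarrow> (x, y) \<in> interp ?N i"
    if A: "A \<in> nsets (univ M) 2" and xy: "x \<in> A" "y \<in> A" and i: "i \<in> metric_lang r" for A x y i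
  proof -
    have "Diag (metric_lang r) N A = Diag (metric_lang r) ?N A"
      using diag A by (simp add: Diag_dist_struct)
    with xy i show ?thesis unfolding Diag_eq_iff by blast
  qed
  have "(x, y) \<in> interp N i \<longleftrightarrow> (x, y) \<in> interp ?N i" for x y i
  proof (cases "i \<in> metric_lang r \<and> x \<in> univ M \<and> y \<in> univ M")
    case False
    with str univ show ?thesis by (auto simp: is_structure_def)
  next
    case True
    have "\<not> univ M \<subseteq> {x}"
      using V card_mono[of "{x}" "univ M"] by auto
    then obtain z where z: "z \<in> univ M" "z \<noteq> x" by blast
    show ?thesis
    proof (cases "x = y")
      case True
      with atoms[of "{x, z}" x y i] z \<open>i \<in> metric_lang r \<and> x \<in> univ M \<and> y \<in> univ M\<close> show ?thesis
        by auto
    qed (use atoms[of "{x, y}" x y i] True in auto)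
  qed
  then have "interp N = interp ?N"
    by (intro ext set_eqI) auto
  then show "N = ?N" using univ by (metis struct.expand univ_dist_struct)
next
  assume "N = dist_struct r (univ M) c"
  with \<phi> show "subpattern_by (metric_lang r) N \<phi> M"
    by (auto simp: subpattern_by_def is_structure_dist_struct Diag_dist_struct)
qed

lemma dist_struct_inj:
  assumes "dist_struct r V c = dist_struct r V c'"
    and A: "A \<in> nsets V 2" and "c A \<in> {1..r}"
  shows "c A = c' A"
proof -
  have "edge_diagram r (c A) A = edge_diagram r (c' A) A"
    using arg_cong[OF assms(1), of "\<lambda>N. Diag (metric_lang r) N A"]
    by (simp only: Diag_dist_struct[OF A])
  moreover have "card A = 2" using A by (simp add: nsets_def)
  ultimately show ?thesis using assms(3) by (rule edge_diagram_inj)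
qed

lemma sub_metric:
  fixes M :: "(nat, 'v :: infinite) pattern"
  assumes fin: "finite (univ M)" and V: "card (univ M) \<ge> 2"
  shows "sub (metric_lang r) (metric_property r) M = (\<Prod>A \<in> nsets (univ M) 2. card (colours r M A))"
proof -
  let ?X = "PiE (nsets (univ M) 2) (colours r M)"
  have "{N. full_subpattern (metric_lang r) (metric_property r) N M} = dist_struct r (univ M) ` ?X"
    (is "?L = ?R")
  proof (intro equalityI subsetI)
    fix N assume "N \<in> ?L"
    then obtain \<phi> c where "subpattern_by (metric_lang r) N \<phi> M" and c: "c \<in> ?X"
      and \<phi>: "\<forall>A \<in> nsets (univ M) 2. \<phi> A = edge_diagram r (c A) A"
      unfolding full_subpattern_def choice_function_metric_iff by blast
    then have "N = dist_struct r (univ M) c"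
      using subpattern_by_metric_iff[OF \<phi> V] by blast
    with c show "N \<in> ?R" by blast
  next
    fix N assume "N \<in> ?R"
    then obtain c where c: "c \<in> ?X" and N: "N = dist_struct r (univ M) c" by blast
    define \<phi> where "\<phi> A = edge_diagram r (c A) A" for A
    have "\<forall>A \<in> nsets (univ M) 2. \<phi> A = edge_diagram r (c A) A"
      by (simp only: \<phi>_def) simp
    then have "choice_function (metric_lang r) (metric_property r) M \<phi>"
      and "subpattern_by (metric_lang r) N \<phi> M"
      using c N subpattern_by_metric_iff[OF _ V] unfolding choice_function_metric_iff by blast+
    then show "N \<in> ?L"
      unfolding full_subpattern_def by blast
  qed
  moreover have "inj_on (dist_struct r (univ M)) ?X"
  proof (rule inj_onI)
    fix c c' assume c: "c \<in> ?X" "c' \<in> ?X" "dist_struct r (univ M) c = dist_struct r (univ M) c'"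
    show "c = c'"
    proof (rule PiE_ext[OF c(1,2)])
      fix A assume A: "A \<in> nsets (univ M) 2"
      then have "c A \<in> colours r M A" using c(1) by auto
      then have "c A \<in> {1..r}" by (simp add: colours_def)
      with c(3) A show "c A = c' A" by (rule dist_struct_inj)
    qed
  qed
  ultimately show ?thesis
    using fin by (simp add: sub_def card_image card_PiE finite_imp_finite_nsets)
qed

text \<open>
  Three distances on a triangle extend to a choice function, since no set of colours is empty. The
  member of the property obtained from it is a metric space, whence the triangle inequality.
\<close>

lemma random_metric_colouring:
  fixes M :: "(nat, 'v :: infinite) pattern"
  assumes M: "random (metric_lang r) (metric_property r) M" and V: "card (univ M) \<ge> 2"
  shows "metric_colouring r (univ M) (colours r M)"
  unfolding metric_colouring_def
proof (intro conjI ballI impI)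
  have ne: "colours r M A \<noteq> {}" if "A \<in> nsets (univ M) 2" for A
    using M that by (intro colours_nonempty) (auto simp: random_def)
  then show "\<And>A. A \<in> nsets (univ M) 2 \<Longrightarrow> colours r M A \<noteq> {}" .
  show "\<And>A. A \<in> nsets (univ M) 2 \<Longrightarrow> colours r M A \<subseteq> {1..r}"
    by (auto simp: colours_def)
  fix u v w i j l
  assume uvw: "u \<in> univ M" "v \<in> univ M" "w \<in> univ M" "u \<noteq> v \<and> v \<noteq> w \<and> u \<noteq> w"
    and ijl: "i \<in> colours r M {u, v}" "j \<in> colours r M {v, w}" "l \<in> colours r M {u, w}"
  define c where "c = restrict ((\<lambda>A. SOME i. i \<in> colours r M A)({u, v} := i, {v, w} := j, {u, w} := l))
    (nsets (univ M) 2)"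
  have c: "c \<in> PiE (nsets (univ M) 2) (colours r M)"
    unfolding c_def using ijl ne by (auto simp: some_in_eq)
  have cv: "c {u, v} = i" "c {v, w} = j" "c {u, w} = l"
    using uvw by (auto simp: c_def doubleton_eq_iff)
  have "choice_function (metric_lang r) (metric_property r) M (\<lambda>A. edge_diagram r (c A) A)"
    unfolding choice_function_metric_iff using c by blast
  then obtain N where "N \<in> metric_property r"
    "subpattern_by (metric_lang r) N (\<lambda>A. edge_diagram r (c A) A) M"
    using M unfolding random_def by blast
  then have "dist_struct r (univ M) c \<in> metric_property r"
    using subpattern_by_metric_iff[OF _ V, of "\<lambda>A. edge_diagram r (c A) A" r c N] by simp
  then obtain c' where c': "dist_struct r (univ M) c = dist_struct r (univ M) c'"
    "metric_colouring r (univ M) (\<lambda>A. {c' A})"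
    by (rule metric_property_distances) simp
  have "c A = c' A" if A: "A \<in> nsets (univ M) 2" for A
  proof (rule dist_struct_inj[OF c'(1) A])
    have "c A \<in> colours r M A" using c A by auto
    then show "c A \<in> {1..r}" by (simp add: colours_def)
  qed
  then have "c' {u, v} = i" "c' {v, w} = j" "c' {u, w} = l"
    using cv uvw by auto
  with c'(2) uvw show "l \<le> i + j"
    unfolding metric_colouring_def by blast
qed

definition template_of :: "nat \<Rightarrow> 'v set \<Rightarrow> ('v set \<Rightarrow> nat set) \<Rightarrow> (nat, 'v) pattern" where
  "template_of r V S = Struct V (\<lambda>p. {(u, v). u \<in> V \<and> v \<in> V \<and> u \<noteq> v \<and> p \<in> dist_type r ` S {u, v}})"

lemma univ_template_of [simp]: "univ (template_of r V S) = V"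
  by (simp add: template_of_def)

lemma interp_template_of:
  "(u, v) \<in> interp (template_of r V S) p \<longleftrightarrow> u \<in> V \<and> v \<in> V \<and> u \<noteq> v \<and> p \<in> dist_type r ` S {u, v}"
  by (simp add: template_of_def)

lemma colours_template_of:
  assumes "A \<in> nsets V 2" "S A \<subseteq> {1..r}"
  shows "colours r (template_of r V S) A = S A"
proof -
  obtain u v where A: "A = {u, v}" "u \<in> V" "v \<in> V" "u \<noteq> v" using assms(1) by (rule nsets2_E)
  have mem: "dist_type r i \<in> dist_type r ` S A \<longleftrightarrow> i \<in> S A" if "i \<in> {1..r}" for i
  proof
    assume "dist_type r i \<in> dist_type r ` S A"
    then obtain j where "j \<in> S A" "dist_type r i = dist_type r j" by blast
    moreover from this(2) have "i = j" by (rule edge_diagram_inj) (use that in auto)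
    ultimately show "i \<in> S A" by blast
  qed (rule imageI)
  have "(\<exists>a b. A = {a, b} \<and> (a, b) \<in> interp (template_of r V S) p) \<longleftrightarrow> p \<in> dist_type r ` S A" for p
  proof
    assume "\<exists>a b. A = {a, b} \<and> (a, b) \<in> interp (template_of r V S) p"
    then obtain a b where "A = {a, b}" "(a, b) \<in> interp (template_of r V S) p" by blast
    then show "p \<in> dist_type r ` S A" by (simp only: interp_template_of)
  next
    assume "p \<in> dist_type r ` S A"
    then have "(u, v) \<in> interp (template_of r V S) p"
      using A by (simp only: interp_template_of not_False_eq_True simp_thms)
    with A(1) show "\<exists>a b. A = {a, b} \<and> (a, b) \<in> interp (template_of r V S) p"
      by (intro exI conjI)
  qed
  then have "colours r (template_of r V S) A = {i \<in> {1..r}. dist_type r i \<in> dist_type r ` S A}"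
    unfolding colours_def by (simp only:)
  also have "\<dots> = {i \<in> {1..r}. i \<in> S A}"
    by (intro Collect_cong conj_cong refl mem)
  also have "\<dots> = S A" using assms(2) by blast
  finally show ?thesis .
qed

text \<open>
  The converse of \<open>random_metric_colouring\<close>: symmetry is built in, because a colouring is defined on
  unordered pairs, and any selection of distances is a metric.
\<close>

lemma random_template_of:
  fixes V :: "'v :: infinite set"
  assumes fin: "finite V" and V: "card V \<ge> 2" and S: "metric_colouring r V S"
  shows "template_of r V S \<in> random_templates (metric_lang r) (metric_property r) (card V)"
proof -
  let ?M = "template_of r V S" and ?L = "metric_lang r" and ?P = "metric_property r :: (nat, 'v) struct set"
  have Sr: "S A \<noteq> {}" "S A \<subseteq> {1..r}" if "A \<in> nsets V 2" for A
    using S that by (auto simp: metric_colouring_def)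
  have str: "is_structure (S2 ?L ?P) ?M"
    unfolding is_structure_def
  proof (intro conjI ballI allI impI)
    show "interp ?M p \<subseteq> univ ?M \<times> univ ?M" for p
      by (auto simp: interp_template_of)
    fix p assume "p \<notin> S2 ?L ?P"
    then have "(u, v) \<notin> interp ?M p" for u v
      using Sr(2)[of "{u, v}"] unfolding interp_template_of S2_metric by auto
    then show "interp ?M p = {}" by auto
  qed
  have complete: "complete ?L ?P ?M"
    unfolding complete_def
  proof (intro conjI str allI impI)
    fix u v assume "{u, v} \<in> nsets (univ ?M) 2"
    then have uv: "{u, v} \<in> nsets V 2" "u \<in> V" "v \<in> V" "u \<noteq> v"
      by simp_all
    obtain i where "i \<in> S {u, v}" "i \<in> {1..r}"
      using Sr[OF uv(1)] by blast
    with uv show "\<exists>p \<in> S2 ?L ?P. (u, v) \<in> interp ?M p \<or> (v, u) \<in> interp ?M p"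
      unfolding S2_metric interp_template_of by blast
  qed
  have template: "template ?L ?P ?M"
    unfolding template_def
  proof (intro conjI complete ballI allI impI)
    show "(u, u) \<notin> interp ?M p" for u p by (simp add: interp_template_of)
    fix p p' \<mu> and a :: "nat \<Rightarrow> 'v"
    assume p: "p \<in> S2 ?L ?P" "p' \<in> S2 ?L ?P" and \<mu>: "\<mu> permutes {1, 2} \<and> p = rename id \<mu> ` p'"
      and a: "a 1 \<in> univ ?M \<and> a 2 \<in> univ ?M \<and> a 1 \<noteq> a 2"
    obtain i where p': "p' = dist_type r i" using p(2) unfolding S2_metric by blast
    have "bij_betw \<mu> {1, 2} {1, 2}" using \<mu> permutes_imp_bij by blast
    then have "rename id \<mu> ` p' = p'" unfolding p' by (rule rename_edge_diagram)
    then have "p = p'" using \<mu> by simp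
    have "\<mu> 1 \<in> {1, 2}" "\<mu> 2 \<in> {1, 2}" "\<mu> 1 \<noteq> \<mu> 2"
      using \<mu> permutes_in_image[of \<mu> "{1, 2}"] permutes_inj[of \<mu> "{1, 2}"]
      by (auto dest: injD)
    then show "(a 1, a 2) \<in> interp ?M p \<longleftrightarrow> (a (\<mu> 1), a (\<mu> 2)) \<in> interp ?M p'"
      unfolding \<open>p = p'\<close> interp_template_of by (auto simp: insert_commute)
  qed
  have "random ?L ?P ?M"
    unfolding random_def
  proof (intro conjI complete allI impI)
    fix \<phi> assume "choice_function ?L ?P ?M \<phi>"
    then obtain c where c: "c \<in> PiE (nsets V 2) (colours r ?M)"
      and \<phi>: "\<forall>A \<in> nsets V 2. \<phi> A = edge_diagram r (c A) A"
      unfolding choice_function_metric_iff by auto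
    have cS: "c A \<in> S A" if "A \<in> nsets V 2" for A
      using c that colours_template_of[of A V S r] Sr by auto
    have "metric_colouring r V (\<lambda>A. {c A})"
      unfolding metric_colouring_def
    proof (intro conjI ballI impI)
      fix A assume "A \<in> nsets V 2"
      then show "{c A} \<noteq> {}" "{c A} \<subseteq> {1..r}" using cS Sr by blast+
    next
      fix u v w i j l
      assume V: "u \<in> V" "v \<in> V" "w \<in> V" "u \<noteq> v \<and> v \<noteq> w \<and> u \<noteq> w"
        and "i \<in> {c {u, v}}" "j \<in> {c {v, w}}" "l \<in> {c {u, w}}"
      then have "i \<in> S {u, v}" "j \<in> S {v, w}" "l \<in> S {u, w}"
        using cS by auto
      with S V show "l \<le> i + j" unfolding metric_colouring_def by blast
    qed
    then have "dist_struct r V c \<in> ?P"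
      using fin by (intro dist_struct_in_metric_property)
    moreover have "subpattern_by ?L (dist_struct r V c) \<phi> ?M"
      using \<phi> V by (subst subpattern_by_metric_iff[of _ _ r c]) auto
    ultimately show "\<exists>N\<in>?P. subpattern_by ?L N \<phi> ?M" by blast
  qed
  with template fin show ?thesis by (simp add: random_templates_def)
qed

lemma sub_template_of:
  fixes V :: "'v :: infinite set"
  assumes "finite V" "card V \<ge> 2" "metric_colouring r V S"
  shows "sub (metric_lang r) (metric_property r) (template_of r V S) = (\<Prod>A \<in> nsets V 2. card (S A))"
proof -
  have "colours r (template_of r V S) A = S A" if "A \<in> nsets V 2" for A
    using that assms(3) by (intro colours_template_of) (auto simp: metric_colouring_def)
  then show ?thesis using assms by (simp add: sub_metric)
qed

lemma sub_random_template_le: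
  fixes M :: "(nat, 'v :: infinite) pattern"
  assumes M: "M \<in> random_templates (metric_lang r) (metric_property r) n"
    and r: "r = 2*q+1" and n: "n \<ge> 2"
  obtains t where "2 * t \<le> n"
    and "sub (metric_lang r) (metric_property r) M \<le> (q+1) ^ (n choose 2) * r ^ t"
    and "t * (n - t) \<le> card {A \<in> nsets (univ M) 2. colours r M A \<noteq> {q..2*q}}"
proof -
  have fin: "finite (univ M)" and card: "card (univ M) = n"
    and rnd: "random (metric_lang r) (metric_property r) M"
    using M by (auto simp: random_templates_def)
  have S: "metric_colouring (2*q+1) (univ M) (colours r M)"
    using random_metric_colouring[OF rnd] card n r by simp
  obtain t where t: "2 * t \<le> card (univ M)"
      "(\<Prod>A\<in>nsets (univ M) 2. card (colours r M A)) \<le> (q + 1) ^ (card (univ M) choose 2) * (2 * q + 1) ^ t"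
      "t * (card (univ M) - t) \<le> (\<Sum>A\<in>nsets (univ M) 2. of_bool (colours r M A \<noteq> {q..2*q}))"
    using prod_card_colouring_le[OF fin S] by blast
  have "(\<Sum>A\<in>nsets (univ M) 2. of_bool (colours r M A \<noteq> {q..2*q}))
      = card {A \<in> nsets (univ M) 2. colours r M A \<noteq> {q..2*q}}"
    using fin by (simp add: sum_of_bool_eq finite_imp_finite_nsets Int_def)
  moreover have "sub (metric_lang r) (metric_property r) M = (\<Prod>A\<in>nsets (univ M) 2. card (colours r M A))"
    using n card by (intro sub_metric fin) simp
  ultimately show ?thesis
    using t by (intro that[of t]) (simp_all only: card r)
qed

text \<open>
  The template \<open>M\<close> ensures that the maximum defining the extremal number is taken over a
  nonempty set; the uniform bound makes that set finite.
\<close>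

lemma
  fixes M :: "(nat, 'v :: infinite) pattern"
  assumes M: "M \<in> random_templates (metric_lang r) (metric_property r) n"
    and r: "r = 2*q+1" and n: "n \<ge> 2"
  shows sub_le_ex_number: "sub (metric_lang r) (metric_property r) M
      \<le> ex_number (metric_lang r) (metric_property r :: (nat, 'v) struct set) n"
    and ex_number_le: "ex_number (metric_lang r) (metric_property r :: (nat, 'v) struct set) n
      \<le> (q+1) ^ (n choose 2) * r ^ (n div 2)"
proof -
  let ?L = "metric_lang r" and ?P = "metric_property r :: (nat, 'v) struct set"
  define X where "X = {sub ?L ?P M | M. M \<in> random_templates ?L ?P n}"
  have le: "sub ?L ?P M \<le> (q+1) ^ (n choose 2) * r ^ (n div 2)"
    if M: "M \<in> random_templates ?L ?P n" for M
  proof -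
    obtain t where "2 * t \<le> n" and t: "sub ?L ?P M \<le> (q+1) ^ (n choose 2) * r ^ t"
      using sub_random_template_le[OF M r n] by metis
    have "r ^ t \<le> r ^ (n div 2)"
      using \<open>2 * t \<le> n\<close> r by (intro power_increasing) auto
    then have "(q+1) ^ (n choose 2) * r ^ t \<le> (q+1) ^ (n choose 2) * r ^ (n div 2)"
      by (rule mult_le_mono2)
    with t show ?thesis by (rule le_trans)
  qed
  have leX: "s \<le> (q+1) ^ (n choose 2) * r ^ (n div 2)" if "s \<in> X" for s
    using that le unfolding X_def by blast
  then have fin: "finite X"
    unfolding finite_nat_set_iff_bounded_le by blast
  have mem: "sub ?L ?P M \<in> X" using M unfolding X_def by blast
  show "sub ?L ?P M \<le> ex_number ?L ?P n"
    unfolding ex_number_def X_def[symmetric] using fin mem by (rule Max_ge)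
  have "Max X \<in> X" using fin mem by (intro Max_in) auto
  then show "ex_number ?L ?P n \<le> (q+1) ^ (n choose 2) * r ^ (n div 2)"
    unfolding ex_number_def X_def[symmetric] by (rule leX)
qed

text \<open>
  A pair with different colours in the two templates has different quantifier-free types, as
  witnessed by an atomic formula.
\<close>

lemma close_colours:
  fixes M M' :: "(nat, 'v :: infinite) pattern"
  assumes close: "close (S2 (metric_lang r) (metric_property r :: (nat, 'v) struct set)) \<delta> M M'"
    and fin: "finite (univ M)"
  shows "real (card {A \<in> nsets (univ M) 2. colours r M A \<noteq> colours r M' A}) \<le> \<delta> * real (card (univ M) choose 2)"
proof -
  let ?L = "S2 (metric_lang r) (metric_property r :: (nat, 'v) struct set)"
  let ?D = "{A \<in> nsets (univ M) 2. \<exists>a. {a 1, a 2} = A \<and> qf_type ?L M a \<noteq> qf_type ?L M' a}"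
  have "{A \<in> nsets (univ M) 2. colours r M A \<noteq> colours r M' A} \<subseteq> ?D"
  proof (intro subsetI, elim CollectE conjE, intro CollectI conjI)
    fix A assume A: "A \<in> nsets (univ M) 2" "colours r M A \<noteq> colours r M' A"
    show "\<exists>a. {a 1, a 2} = A \<and> qf_type ?L M a \<noteq> qf_type ?L M' a"
    proof (rule ccontr)
      assume *: "\<not> ?thesis"
      have eq: "(u, v) \<in> interp M (dist_type r i) \<longleftrightarrow> (u, v) \<in> interp M' (dist_type r i)"
        if "i \<in> {1..r}" "A = {u, v}" for i u v
      proof -
        define a where "a k = (if k = (1::nat) then u else v)" for k
        have "{a 1, a 2} = A" using that(2) by (simp add: a_def)
        with * have "qf_type ?L M a = qf_type ?L M' a" by blast
        moreover have "Rel (dist_type r i) 1 2 \<in> qf_type ?L M'' a \<longleftrightarrow> (u, v) \<in> interp M'' (dist_type r i)"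
          for M'' :: "(nat, 'v) pattern"
          using that(1) by (simp add: qf_type_def qf_formulas_def S2_metric a_def)
        ultimately show ?thesis by blast
      qed
      have "colours r M A = colours r M' A"
        unfolding colours_def by (intro Collect_cong conj_cong refl ex_cong1 eq)
      with A(2) show False by blast
    qed
  qed
  then have "card {A \<in> nsets (univ M) 2. colours r M A \<noteq> colours r M' A} \<le> card ?D"
    using fin by (intro card_mono) (auto simp: finite_imp_finite_nsets)
  with close show ?thesis unfolding close_def by linarith
qed

section \<open>Two templates\<close>

lemma metric_colouring_lower:
  assumes "q \<ge> 1"
  shows "metric_colouring (2*q+1) V (\<lambda>_. {q..2*q})"
  using assms by (auto simp: metric_colouring_def)

text \<open>
  The triangle inequality could only fail for a side \<open>2q + 1\<close> opposite to two sides \<open>q\<close>, that is, to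
  two edges of \<open>E\<close> with a common point.
\<close>

lemma metric_colouring_matching:
  assumes q: "q \<ge> 1"
    and E: "\<And>A B. A \<in> E \<Longrightarrow> B \<in> E \<Longrightarrow> A \<inter> B \<noteq> {} \<Longrightarrow> A = B"
  shows "metric_colouring (2*q+1) V (\<lambda>A. if A \<in> E then {q..2*q+1} else {q+1..2*q+1})"
proof -
  have "{u, v} \<notin> E \<or> {v, w} \<notin> E" if "u \<noteq> v" "v \<noteq> w" "u \<noteq> w" for u v w
    using E[of "{u, v}" "{v, w}"] that by (auto simp: doubleton_eq_iff)
  with q show ?thesis
    unfolding metric_colouring_def by (fastforce split: if_splits)
qed

lemma ex_perfect_matching:
  obtains V :: "'v :: infinite set" and E where "finite V" "card V = 2 * h"
    "E \<subseteq> nsets V 2" "card E = h"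
    "\<And>A B. A \<in> E \<Longrightarrow> B \<in> E \<Longrightarrow> A \<inter> B \<noteq> {} \<Longrightarrow> A = B"
proof -
  obtain f :: "nat \<Rightarrow> 'v" where f: "inj f"
    using infinite_countable_subset[OF infinite_UNIV] by blast
  let ?e = "\<lambda>i. {f (2*i), f (2*i+1)}"
  have f_eq: "f i = f j \<longleftrightarrow> i = j" for i j using f by (auto dest: injD)
  have disj: "i = j" if "?e i \<inter> ?e j \<noteq> {}" for i j
  proof -
    have "2 * i = 2 * j \<or> 2 * i = 2 * j + 1 \<or> 2 * i + 1 = 2 * j \<or> 2 * i + 1 = 2 * j + 1"
      using that by (auto simp: f_eq)
    then show ?thesis by presburger
  qed
  show ?thesis
  proof (rule that[of "f ` {..<2*h}" "?e ` {..<h}"])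
    show "card (f ` {..<2*h}) = 2 * h" using f by (simp add: card_image inj_on_subset)
    show "?e ` {..<h} \<subseteq> nsets (f ` {..<2*h}) 2" by (auto simp: f_eq)
    have "inj_on ?e {..<h}" by (rule inj_onI) (metis disj Int_absorb insert_not_empty)
    then show "card (?e ` {..<h}) = h" by (simp add: card_image)
    fix A B assume "A \<in> ?e ` {..<h}" "B \<in> ?e ` {..<h}" "A \<inter> B \<noteq> {}"
    then show "A = B" using disj by blast
  qed simp
qed

lemma prod_card_matching:
  assumes "finite V" "E \<subseteq> nsets V 2"
  shows "(\<Prod>A\<in>nsets V 2. card (if A \<in> E then {q..2*q+1} else {q+1..2*q+1}))
    = (q+2) ^ card E * (q+1) ^ ((card V choose 2) - card E)"
proof -
  have fin: "finite (nsets V 2)" using assms by (simp add: finite_imp_finite_nsets)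
  have "(\<Prod>A\<in>nsets V 2. card (if A \<in> E then {q..2*q+1} else {q+1..2*q+1}))
      = (\<Prod>A\<in>nsets V 2 - E. q + 1) * (\<Prod>A\<in>E. q + 2)"
    unfolding prod.subset_diff[OF assms(2) fin] by (intro arg_cong2[of _ _ _ _ "(*)"] prod.cong) auto
  then show ?thesis
    using fin assms by (simp add: card_Diff_subset finite_subset card_pairs)
qed

section \<open>Failure of stability\<close>

text \<open>
  By Bernoulli's inequality, \<open>r k\<close> factors \<open>1 + 1 / k\<close> outweigh one factor \<open>r\<close>.
\<close>

lemma matching_gain:
  fixes r k t h :: nat
  assumes "k \<ge> 1" "t * (r * k) < h"
  shows "k ^ h * r ^ t < (k + 1) ^ h"
proof -
  have "1 + real (r * k) * (1 / real k) \<le> (1 + 1 / real k) ^ (r * k)"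
    by (rule Bernoulli_inequality) (use assms in \<open>simp add: order_trans[of _ 0]\<close>)
  then have "real r \<le> (1 + 1 / real k) ^ (r * k)"
    using assms(1) by simp
  also have "1 + 1 / real k = real (k + 1) / real k"
    using assms(1) by (simp add: field_simps)
  finally have "real (k ^ (r * k) * r) \<le> real ((k + 1) ^ (r * k))"
    using assms(1) by (simp add: power_divide field_simps)
  then have one: "k ^ (r * k) * r \<le> (k + 1) ^ (r * k)"
    by (simp only: of_nat_le_iff)
  obtain m where m: "h = (r * k) * t + m" "m > 0"
    using assms(2) by (metis less_imp_add_positive mult.commute)
  have "k ^ h * r ^ t = (k ^ (r * k) * r) ^ t * k ^ m"
    unfolding m by (simp add: power_add power_mult power_mult_distrib)
  also have "\<dots> \<le> ((k + 1) ^ (r * k)) ^ t * k ^ m"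
    by (intro mult_right_mono power_mono one) auto
  also have "\<dots> < ((k + 1) ^ (r * k)) ^ t * (k + 1) ^ m"
    using m by (intro mult_strict_left_mono power_strict_mono) auto
  also have "\<dots> = (k + 1) ^ h"
    unfolding m by (simp add: power_add power_mult)
  finally show ?thesis .
qed

text \<open>
  With \<open>h\<close> linear and \<open>C\<close> quadratic in the number of points, the factor \<open>r ^ h\<close> is absorbed by
  any positive \<open>\<epsilon>\<close>.
\<close>

lemma powr_one_minus_le:
  fixes x k r C h :: nat and \<epsilon> :: real
  assumes "k \<ge> 2" "r \<ge> 1" "k ^ C \<le> x" "x \<le> k ^ C * r ^ h" "\<epsilon> > 0"
    and small: "real h * ln r \<le> \<epsilon> * real C * ln k"
  shows "real x powr (1 - \<epsilon>) \<le> real (k ^ C)"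
proof -
  have "k ^ C > 0" using assms by simp
  then have "x > 0" using assms(3) by linarith
  have "real x \<le> real (k ^ C * r ^ h)" using assms(4) by (rule of_nat_mono)
  then have "ln (real x) \<le> ln (real (k ^ C * r ^ h))"
    using \<open>x > 0\<close> by simp
  also have "\<dots> = real C * ln k + real h * ln r"
    using assms by (simp add: ln_mult ln_realpow)
  finally have 1: "ln (real x) \<le> real C * ln k + real h * ln r" .
  have "real (k ^ C) \<le> real x" using assms(3) by (rule of_nat_mono)
  then have "ln (real (k ^ C)) \<le> ln (real x)"
    using \<open>k ^ C > 0\<close> \<open>x > 0\<close> by simp
  then have "\<epsilon> * (real C * ln k) \<le> \<epsilon> * ln (real x)"
    using assms by (intro mult_left_mono) (auto simp: ln_realpow)
  with 1 small have "(1 - \<epsilon>) * ln (real x) \<le> real C * ln k"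
    by (simp add: algebra_simps)
  then have "exp ((1 - \<epsilon>) * ln (real x)) \<le> exp (real C * ln k)" by simp
  also have "exp (real C * ln k) = real (k ^ C)"
    using assms by (simp add: exp_of_nat_mult)
  finally show ?thesis using \<open>x > 0\<close> by (simp add: powr_def)
qed

theorem corollary5:
  fixes r :: nat
  assumes "r \<ge> 3" and "odd r"
  shows "\<not> has_stability_theorem (metric_lang r)
           (metric_property r :: (nat, 'v :: infinite) struct set)"
proof
  assume stab: "has_stability_theorem (metric_lang r) (metric_property r :: (nat, 'v) struct set)"
  obtain q where r: "r = 2 * q + 1" using assms(2) by (rule oddE)
  with assms(1) have q: "q \<ge> 1" by simp
  let ?L = "metric_lang r" and ?P = "metric_property r :: (nat, 'v) struct set"
  \<comment> \<open>chosen so that \<open>t \<le> \<delta> (2 h - 1)\<close> makes \<open>matching_gain\<close> applicable with \<open>k = q + 1\<close>\<close>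
  define \<delta> where "\<delta> = 1 / (2 * real (r * (q + 1)))"
  have pos: "0 < real (r * (q + 1))" using assms(1) by (simp del: of_nat_mult)
  then have "\<delta> > 0" unfolding \<delta>_def by (intro divide_pos_pos mult_pos_pos) simp_all
  then obtain \<epsilon> n0 where "\<epsilon> > 0" and stable: "\<And>n M. n > n0 \<Longrightarrow> M \<in> random_templates ?L ?P n \<Longrightarrow>
      real (ex_number ?L ?P n) powr (1 - \<epsilon>) \<le> real (sub ?L ?P M) \<Longrightarrow>
      \<exists>M' \<in> extremal_templates ?L ?P n. close (S2 ?L ?P) \<delta> M M'"
    using stab unfolding has_stability_theorem_def by meson
  have lnk: "ln (real (q + 1)) > 0" using q by simp
  obtain m where m: "ln (real r) / (\<epsilon> * ln (real (q + 1))) \<le> real m"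
    using real_arch_simple by blast
  \<comment> \<open>The number \<open>2 h\<close> of points is even for the sake of a perfect matching; \<open>h > n0\<close> is needed for
    stability, and \<open>h \<ge> m\<close> for \<open>powr_one_minus_le\<close>.\<close>
  define h where "h = m + n0 + 1"
  define C where "C = (2 * h) choose 2"
  have h: "h \<ge> 1" "h > n0" "real m \<le> real h" by (auto simp: h_def)
  have C: "C = h * (2 * h - 1)" by (simp add: C_def choose_two)
  have "ln (real r) \<le> \<epsilon> * ln (real (q + 1)) * real m"
    using m lnk \<open>\<epsilon> > 0\<close> by (simp add: field_simps)
  also have "\<dots> \<le> \<epsilon> * ln (real (q + 1)) * real (2 * h - 1)"
    using h lnk \<open>\<epsilon> > 0\<close> by (intro mult_left_mono) auto
  finally have "real h * ln (real r) \<le> real h * (\<epsilon> * ln (real (q + 1)) * real (2 * h - 1))"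
    by (intro mult_left_mono) auto
  also have "\<dots> = \<epsilon> * real C * ln (real (q + 1))"
    by (simp add: C)
  finally have small: "real h * ln (real r) \<le> \<epsilon> * real C * ln (real (q + 1))" .
  obtain V :: "'v set" and E where V: "finite V" "card V = 2 * h"
    and E: "E \<subseteq> nsets V 2" "card E = h"
      "\<And>A B. A \<in> E \<Longrightarrow> B \<in> E \<Longrightarrow> A \<inter> B \<noteq> {} \<Longrightarrow> A = B"
    using ex_perfect_matching by metis
  have V2: "card V \<ge> 2" using V h by simp
  have h2: "2 * h \<ge> 2" using h by simp
  define M where "M = template_of r V (\<lambda>_. {q..2*q})"
  have col: "metric_colouring r V (\<lambda>_. {q..2*q})"
    unfolding r by (rule metric_colouring_lower[OF q])
  have M: "M \<in> random_templates ?L ?P (2 * h)"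
    unfolding M_def using random_template_of[OF V(1) V2 col] V(2) by simp
  have subM: "sub ?L ?P M = (q + 1) ^ C"
    unfolding M_def using sub_template_of[OF V(1) V2 col] V by (simp add: C_def card_pairs)
  define S where "S A = (if A \<in> E then {q..2*q+1} else {q+1..2*q+1})" for A
  have colS: "metric_colouring r V S"
    unfolding r S_def by (rule metric_colouring_matching[OF q E(3)])
  have subS: "sub ?L ?P (template_of r V S) = (q + 2) ^ h * (q + 1) ^ (C - h)"
    using sub_template_of[OF V(1) V2 colS] prod_card_matching[OF V(1) E(1)] V E(2)
    by (simp add: S_def C_def)
  have "template_of r V S \<in> random_templates ?L ?P (2 * h)"
    using random_template_of[OF V(1) V2 colS] V(2) by simp
  from sub_le_ex_number[OF this r h2]
  have ex_ge: "(q + 2) ^ h * (q + 1) ^ (C - h) \<le> ex_number ?L ?P (2 * h)"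
    unfolding subS .
  have "(q + 1) ^ C \<le> ex_number ?L ?P (2 * h)"
    using sub_le_ex_number[OF M r h2] unfolding subM .
  moreover have "ex_number ?L ?P (2 * h) \<le> (q + 1) ^ C * r ^ h"
    using ex_number_le[OF M r h2] by (simp add: C_def)
  ultimately have "real (ex_number ?L ?P (2 * h)) powr (1 - \<epsilon>) \<le> real (sub ?L ?P M)"
    unfolding subM using small \<open>\<epsilon> > 0\<close> q r by (intro powr_one_minus_le) auto
  then obtain M' where M': "M' \<in> extremal_templates ?L ?P (2 * h)" "close (S2 ?L ?P) \<delta> M M'"
    using stable[OF _ M] h by force
  have rM': "M' \<in> random_templates ?L ?P (2 * h)" and subM': "sub ?L ?P M' = ex_number ?L ?P (2 * h)"
    using M'(1) by (simp_all add: extremal_templates_def)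
  obtain t where t: "2 * t \<le> 2 * h" "sub ?L ?P M' \<le> (q + 1) ^ (2 * h choose 2) * r ^ t"
    "t * (2 * h - t) \<le> card {A \<in> nsets (univ M') 2. colours r M' A \<noteq> {q..2*q}}"
    by (rule sub_random_template_le[OF rM' r h2])
  have "univ M = univ M'" using M'(2) unfolding close_def by blast
  then have univ: "univ M = V" "univ M' = V" by (simp_all add: M_def)
  have "colours r M A = {q..2*q}" if "A \<in> nsets V 2" for A
    unfolding M_def using that q by (subst colours_template_of) (auto simp: r)
  then have eq: "{A \<in> nsets V 2. colours r M A \<noteq> colours r M' A} = {A \<in> nsets V 2. colours r M' A \<noteq> {q..2*q}}"
    by auto
  \<comment> \<open>Closeness limits the number of pairs not coloured \<open>{q..2q}\<close>, and hence \<open>t\<close>.\<close>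
  have "t * h \<le> t * (2 * h - t)" using t(1) by (intro mult_left_mono) auto
  with t(3) have "real (t * h) \<le> real (card {A \<in> nsets V 2. colours r M' A \<noteq> {q..2*q}})"
    unfolding univ by linarith
  also have "\<dots> \<le> \<delta> * real C"
    using close_colours[OF M'(2)] V unfolding univ eq C_def by simp
  finally have "real (t * h) * (2 * real (r * (q + 1))) \<le> real C"
    using pos unfolding \<delta>_def by (simp add: pos_le_divide_eq del: of_nat_mult)
  then have "real (t * h * (2 * (r * (q + 1)))) \<le> real C" by simp
  then have "h * (2 * (t * (r * (q + 1)))) \<le> h * (2 * h - 1)"
    unfolding C of_nat_le_iff by (simp add: mult_ac)
  then have "2 * (t * (r * (q + 1))) \<le> 2 * h - 1"
    using h by simp
  then have "t * (r * (q + 1)) < h" using h by linarith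
  then have "(q + 1) ^ h * r ^ t < (q + 2) ^ h"
    using matching_gain[of "q + 1" t r h] by simp
  then have "(q + 1) ^ h * r ^ t * (q + 1) ^ (C - h) < (q + 2) ^ h * (q + 1) ^ (C - h)"
    by (intro mult_strict_right_mono) auto
  also have "\<dots> \<le> (q + 1) ^ C * r ^ t"
    using ex_ge t(2) unfolding subM' C_def[symmetric] by (rule le_trans)
  also have "(q + 1) ^ C = (q + 1) ^ h * (q + 1) ^ (C - h)"
    using h by (simp add: C flip: power_add)
  finally show False by (simp only: mult_ac less_irrefl)
qed

end
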